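(* Let $C_1, C_2, C_3, C_4, C_5, C_6$ be real numbers from $(0,1)$ satisfying the following inequalities: \begin{align*} C_1 < C_3 &< C_5 \\ C_2 + C_4 &\geq 1 \\ C_1+C_2+C_3 &\leq 1 \\ \frac{C_2}{C_1}> \frac{C_4-C_2}{C_3-C_1} > \frac{C_6-C_4}{C_5-C_3} = 1 &> \frac{1-C_6}{1-C_5} \end{align*} Let $e(\alpha)$ be the piecewise linear function connecting the points $$[0,0], \qquad [C_1, C_2], \qquad [C_3,C_4], \qquad [C_5,C_6], \qquad [1,1].$$ Suppose that for every $N$ the graph $E_N$ is a bipartite graph with $N$ left vertices $\{x_1, \dots, x_N\}$ and $N$ right vertices $\{y_1, \dots, y_N\}$ and edges directed from left to right with the following properties: \begin{enumerate}[(a)] \item $E_N$ is an $(N, \alpha, e(\alpha))$-expander for every $\alpha\in[0,1]$. \item $E_N$ is an $(N,\alpha ,1)$-pair-expander for every $\alpha \in [0,C_3]$ where the pairs are $(y_i, y_{i+N/2})$ for $i \in \{1,\dots, N/2\}$. \end{enumerate} Then $\Gamma_N$ is an $N$-superconcentrator.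
   Context: An $N$-superconcentrator is a directed acyclic graph with exactly $N$ input nodes $I$ and $N$ output nodes $O$ such that for every $S\subset I$, $T\subset O$ with $|S|=|T|=k$ there exist $k$ node-disjoint paths connecting $S$ to $T$. A bipartite graph with $N$ left vertices $L$, $N$ right vertices $R$ and edges directed from $L$ to $R$ is an $(N,\alpha,\beta)$-expander ($\alpha,\beta\in[0,1]$) if every $S\subset L$ with $|S|=\lfloor\alpha N\rfloor$ has $|\Gamma(S)|\ge\lceil\beta N\rceil$, where $\Gamma(S)\subset R$ is the set of neighbours of $S$. Assume $N$ is even and the right vertices $R$ are grouped into pairs. A left vertex is adjacent to a pair if it is adjacent to at least one vertex of the pair; a set $U\subset L$ is adjacent to a pair if some vertex of $U$ is. Such a graph is an $(N,\alpha,\gamma)$-pair-expander if every $U\subset L$ with $|U|=k=\lfloor\alpha N\rfloor$ is adjacent to at least $\lfloor\gamma k\rfloor$ pairs. The graph $\Gamma_N$ (for sufficiently large $N$) is defined recursively: let $X$, $Y$ be disjoint sets of $N$ vertices (inputs and outputs of $\Gamma_N$), and $X'=\{x'_1,\dots,x'_N\}$, $Y'=\{y'_1,\dots,y'_N\}$ further disjoint sets. A copy of $E_N$ is placed between $X$ and $X'$ with edges directed from $X$ to $X'$ (edge set $\Lambda_X$), and a copy of the reverse of $E_N$ is placed between $Y'$ and $Y$ with edges directed from $Y'$ to $Y$ (edge set $\Lambda_Y$). For each $i\in\{1,\dots,N/2\}$, the edges $(x'_{i+N/2},y'_i)$, $(x'_{i+N/2},x'_i)$, $(x'_i,y'_{i+N/2})$,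 $(y'_i,y'_{i+N/2})$ are in $\Gamma_N$. Finally, with $X''=\{x'_i : i\le N/2\}$ and $Y''=\{y'_i : i\le N/2\}$, the edges of the superconcentrator $\Gamma_{N/2}$ are placed between $X''$ (inputs) and $Y''$ (outputs), where $\Gamma_{N/2}$ is built in the same way from $E_{N/2}$.
   Formalization: The expander condition is required only for nonempty S (for 0<αN<1 the empty set would violate it), and the unspecified start of the recursion is taken, below an arbitrary threshold, to be any superconcentrator whose inputs are sources and outputs are sinks. *)

theory Defs
  imports Complex_Main "HOL-Library.Disjoint_Sets"
    "Graph_Theory.Pair_Digraph" "Graph_Theory.Vertex_Walk"
begin

definition superconcentrator ::
    "nat \<Rightarrow> 'v pair_pre_digraph \<Rightarrow> 'v set \<Rightarrow> 'v set \<Rightarrow> bool" where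
  "superconcentrator N G I J \<longleftrightarrow>
     pair_fin_digraph G \<and> acyclic (parcs G) \<and>
     I \<subseteq> pverts G \<and> J \<subseteq> pverts G \<and> I \<inter> J = {} \<and> card I = N \<and> card J = N \<and>
     (\<forall>S T. S \<subseteq> I \<and> T \<subseteq> J \<and> card S = card T \<longrightarrow>
        (\<exists>P. finite P \<and> card P = card S \<and> disjoint_family_on set P \<and>
             (\<forall>p\<in>P. vpath p (with_proj G) \<and> hd p \<in> S \<and> last p \<in> T)))"

text \<open>
  A bipartite graph with left vertices \<open>x\<^sub>1, \<dots>, x\<^sub>N\<close> and right vertices
  \<open>y\<^sub>1, \<dots>, y\<^sub>N\<close> is given by the set of index pairs \<open>(i, j)\<close> of its edges
  \<open>(x\<^sub>i, y\<^sub>j)\<close>, so the set of neighbours of a left set \<open>S\<close> is \<open>E `` S\<close>.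
\<close>

definition bipartite_edges :: "nat \<Rightarrow> (nat \<times> nat) set \<Rightarrow> bool" where
  "bipartite_edges N E \<longleftrightarrow> E \<subseteq> {1..N} \<times> {1..N}"

text \<open>
  The empty set is excluded: for \<open>0 < \<alpha> N < 1\<close> it is the only set of size
  \<open>\<lfloor>\<alpha> N\<rfloor>\<close>, and it has no \<open>\<lceil>\<beta> N\<rceil>\<close> neighbours unless \<open>\<beta> = 0\<close>.
\<close>

definition expander :: "nat \<Rightarrow> real \<Rightarrow> real \<Rightarrow> (nat \<times> nat) set \<Rightarrow> bool" where
  "expander N \<alpha> \<beta> E \<longleftrightarrow>
     (\<forall>S \<subseteq> {1..N}. S \<noteq> {} \<and> int (card S) = \<lfloor>\<alpha> * real N\<rfloor> \<longrightarrow>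
        \<lceil>\<beta> * real N\<rceil> \<le> int (card (E `` S)))"

definition half_pairs :: "nat \<Rightarrow> nat set set" where
  "half_pairs N = (\<lambda>i. {i, i + N div 2}) ` {1..N div 2}"

definition pair_expander ::
    "nat \<Rightarrow> real \<Rightarrow> real \<Rightarrow> nat set set \<Rightarrow> (nat \<times> nat) set \<Rightarrow> bool" where
  "pair_expander N \<alpha> \<gamma> Q E \<longleftrightarrow>
     (\<forall>U \<subseteq> {1..N}. int (card U) = \<lfloor>\<alpha> * real N\<rfloor> \<longrightarrow>
        \<lfloor>\<gamma> * real (card U)\<rfloor> \<le> int (card {q \<in> Q. E `` U \<inter> q \<noteq> {}}))"

definition pw_linear ::
    "real \<Rightarrow> real \<Rightarrow> real \<Rightarrow> real \<Rightarrow> real \<Rightarrow> real \<Rightarrow> real \<Rightarrow> real" where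
  "pw_linear C1 C2 C3 C4 C5 C6 \<alpha> =
     (if \<alpha> \<le> C1 then C2 / C1 * \<alpha>
      else if \<alpha> \<le> C3 then C2 + (C4 - C2) / (C3 - C1) * (\<alpha> - C1)
      else if \<alpha> \<le> C5 then C4 + (C6 - C4) / (C5 - C3) * (\<alpha> - C3)
      else C6 + (1 - C6) / (1 - C5) * (\<alpha> - C5))"

text \<open>
  \<open>Gamma E N\<^sub>0 N G x y\<close>: the digraph \<open>G\<close> is a copy of \<open>\<Gamma>\<^sub>N\<close> with inputs
  \<open>x 1, \<dots>, x N\<close> and outputs \<open>y 1, \<dots>, y N\<close>. The recursive construction is used
  from the threshold \<open>N\<^sub>0\<close> on; below it, any superconcentrator may be taken whose inputs are
  sources and whose outputs are sinks. In the recursive rule, \<open>x' i\<close> and \<open>y' i\<close>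
  with \<open>i \<le> N div 2\<close> are the inputs and outputs of the copy \<open>H\<close> of
  \<open>\<Gamma>\<close> of size \<open>N div 2\<close>; all other vertices listed are new.
\<close>

inductive Gamma ::
    "(nat \<Rightarrow> (nat \<times> nat) set) \<Rightarrow> nat \<Rightarrow> nat \<Rightarrow> 'v pair_pre_digraph \<Rightarrow>
     (nat \<Rightarrow> 'v) \<Rightarrow> (nat \<Rightarrow> 'v) \<Rightarrow> bool"
  for E :: "nat \<Rightarrow> (nat \<times> nat) set" and N\<^sub>0 :: nat
where
  base: "Gamma E N\<^sub>0 N G x y"
    if "N < N\<^sub>0"
      and "superconcentrator N G (x ` {1..N}) (y ` {1..N})"
      and "\<And>u v. (u, v) \<in> parcs G \<Longrightarrow> v \<notin> x ` {1..N} \<and> u \<notin> y ` {1..N}"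
| step: "Gamma E N\<^sub>0 N
      \<lparr>pverts = pverts H \<union> x ` {1..N} \<union> y ` {1..N} \<union> x' ` {1..N} \<union> y' ` {1..N},
       parcs = parcs H
         \<union> {(x i, x' j) | i j. (i, j) \<in> E N}
         \<union> {(y' j, y i) | i j. (i, j) \<in> E N}
         \<union> (\<Union>i\<in>{1..N div 2}.
              {(x' (i + N div 2), y' i), (x' (i + N div 2), x' i),
               (x' i, y' (i + N div 2)), (y' i, y' (i + N div 2))})\<rparr> x y"
    if "N\<^sub>0 \<le> N" and "even N"
      and "Gamma E N\<^sub>0 (N div 2) H x' y'"
      and "distinct (map x [1..<Suc N] @ map y [1..<Suc N] @
                     map x' [1..<Suc N] @ map y' [1..<Suc N])"
      and "(x ` {1..N} \<union> y ` {1..N} \<union> x' ` {N div 2<..N} \<union> y' ` {N div 2<..N})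
             \<inter> pverts H = {}"

end

theory Submission
  imports Defs
begin

text \<open>
  Replace the inner copy of \<open>\<Gamma>\<^bsub>N/2\<^esub>\<close> by the complete bipartite graph between its inputs and
  outputs; paths through it can afterwards be rerouted through the real one. In the resulting
  graph, \<open>k\<close> disjoint paths from \<open>S\<close> to \<open>T\<close> are the same as an injection that moves every
  vertex outside \<open>T\<close> along an arc or fixes it and avoids \<open>S\<close>, so they are provided by Hall's
  theorem. Counting pair by pair, Hall's condition becomes
  \<open>|U| + |V| \<le> k + \<Sum>\<^sub>i min(g\<^sub>i, h\<^sub>i + 1)\<close> for \<open>U \<subseteq> S\<close>, \<open>V \<subseteq> T\<close>, where \<open>g\<^sub>i\<close> and \<open>h\<^sub>i\<close> are the
  numbers of neighbours of \<open>U\<close> and \<open>V\<close> in the \<open>i\<close>-th pair, together with the same inequality with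
  \<open>g\<close> and \<open>h\<close> exchanged. If \<open>|U|\<close> or \<open>|V|\<close> is at most \<open>C\<^sub>3 N\<close>, this is pair expansion. Otherwise it
  follows from \<open>3 e(t) \<ge> 1 + 2 t\<close> on \<open>[C\<^sub>3, 1]\<close>, where \<open>e\<close> is linear on \<open>[C\<^sub>3, C\<^sub>5]\<close> and
  \<open>[C\<^sub>5, 1]\<close>; at \<open>t = C\<^sub>3\<close> it is the sum of \<open>C\<^sub>4 \<ge> 1 - C\<^sub>2\<close>, \<open>C\<^sub>4 \<ge> C\<^sub>2 + C\<^sub>3 - C\<^sub>1\<close> and
  \<open>C\<^sub>4 \<ge> 1 - C\<^sub>2 \<ge> C\<^sub>1 + C\<^sub>3\<close>.
\<close>

subsection \<open>Hall's theorem and linkings\<close>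

text \<open>Induction on the index set. If some nonempty proper \<open>J\<close> is tight, match
  \<open>J\<close> first and the other indices outside the values available to \<open>J\<close>. If
  none is tight, every nonempty proper subset has a surplus of one, so any single choice
  \<open>a\<close> for any index \<open>i\<close> can be fixed and removed.\<close>

lemma hall_marriage:
  assumes "finite I" "\<And>i. i \<in> I \<Longrightarrow> finite (F i)"
    and "\<And>J. J \<subseteq> I \<Longrightarrow> card J \<le> card (\<Union>(F ` J))"
  shows "\<exists>R. inj_on R I \<and> (\<forall>i\<in>I. R i \<in> F i)"
  using assms
proof (induction I arbitrary: F rule: finite_psubset_induct)
  case (psubset I)
  note fin = psubset.prems(1) and hall = psubset.prems(2)
  show ?case
  proof (cases "\<exists>J. J \<noteq> {} \<and> J \<subset> I \<and> card (\<Union>(F ` J)) = card J")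
    case True
    then obtain J where J: "J \<noteq> {}" "J \<subset> I" "card (\<Union>(F ` J)) = card J" by blast
    have fJ: "finite J" using J(2) psubset.hyps finite_subset by blast
    obtain R1 where R1: "inj_on R1 J" "\<forall>i\<in>J. R1 i \<in> F i"
      using psubset.IH[OF J(2), of F] fin hall J(2) by auto
    let ?F = "\<lambda>i. F i - \<Union>(F ` J)"
    \<comment> \<open>Hall's condition for \<open>K \<union> J\<close>, minus the exact count for
      \<open>J\<close>, leaves Hall's condition for \<open>K\<close>.\<close>
    have "card K \<le> card (\<Union>(?F ` K))" if K: "K \<subseteq> I - J" for K
    proof -
      have fK: "finite K" using K psubset.hyps finite_subset by blast
      have "card K + card J = card (K \<union> J)"
        using K fK fJ by (intro card_Un_disjoint[symmetric]) auto
      also have "\<dots> \<le> card (\<Union>(F ` (K \<union> J)))" using K J(2) by (intro hall) auto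
      also have "\<Union>(F ` (K \<union> J)) = \<Union>(?F ` K) \<union> \<Union>(F ` J)" by auto
      also have "card \<dots> \<le> card (\<Union>(?F ` K)) + card J" using card_Un_le J(3) by metis
      finally show ?thesis by simp
    qed
    moreover have "I - J \<subset> I" using J by auto
    ultimately obtain R2 where R2: "inj_on R2 (I - J)" "\<forall>i\<in>I - J. R2 i \<in> ?F i"
      using psubset.IH[of "I - J" ?F] fin by auto
    have R1_in: "R1 i \<in> \<Union>(F ` J)" if "i \<in> J" for i using that R1(2) by auto
    have R2_notin: "R2 i \<notin> \<Union>(F ` J)" if "i \<in> I" "i \<notin> J" for i using that R2(2) by auto
    have "inj_on (\<lambda>i. if i \<in> J then R1 i else R2 i) I"
    proof (rule inj_onI)
      fix i j assume "i \<in> I" "j \<in> I" "(if i \<in> J then R1 i else R2 i) = (if j \<in> J then R1 j else R2 j)"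
      then show "i = j"
        using R1_in[of i] R1_in[of j] R2_notin[of i] R2_notin[of j]
          inj_onD[OF R1(1), of i j] inj_onD[OF R2(1), of i j] by (simp split: if_splits)
    qed
    then show ?thesis using R1(2) R2(2) by (intro exI[of _ "\<lambda>i. if i \<in> J then R1 i else R2 i"]) auto
  next
    case False
    then have loose: "card (\<Union>(F ` J)) \<noteq> card J" if "J \<noteq> {}" "J \<subset> I" for J
      using that by auto
    show ?thesis
    proof (cases "I = {}")
      case False
      then obtain i where i: "i \<in> I" by blast
      have "F i \<noteq> {}" using hall[of "{i}"] i by auto
      then obtain a where a: "a \<in> F i" by blast
      let ?F = "\<lambda>j. F j - {a}"
      \<comment> \<open>Deleting \<open>a\<close> costs at most one value, which the strict
        inequality for \<open>K\<close> pays for.\<close>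
      have "card K \<le> card (\<Union>(?F ` K))" if K: "K \<subseteq> I - {i}" for K
      proof (cases "K = {}")
        case False
        have "K \<subset> I" using K i by auto
        then have "card K < card (\<Union>(F ` K))"
          using loose[OF False] hall[of K] by (simp add: psubset_imp_subset order_less_le)
        moreover have "\<Union>(?F ` K) = \<Union>(F ` K) - {a}" by auto
        ultimately show ?thesis by (auto simp: card_Diff_singleton_if)
      qed simp
      moreover have "I - {i} \<subset> I" using i by auto
      ultimately obtain R where R: "inj_on R (I - {i})" "\<forall>j\<in>I - {i}. R j \<in> ?F j"
        using psubset.IH[of "I - {i}" ?F] fin by auto
      then have "inj_on (R(i := a)) I" by (auto simp: inj_on_def)
      then show ?thesis using R(2) a by (intro exI[of _ "R(i := a)"] conjI) (assumption, simp)
    qed simp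
  qed
qed

text \<open>
  A linking encodes vertex-disjoint paths as an injection: a vertex on a path is sent to its
  successor, a vertex off the paths to itself, and the orbits of the points of \<open>S\<close> are the paths.
\<close>

definition linking :: "'v set \<Rightarrow> ('v \<times> 'v) set \<Rightarrow> 'v set \<Rightarrow> 'v set \<Rightarrow> ('v \<Rightarrow> 'v) \<Rightarrow> bool" where
  "linking V A S T \<sigma> \<longleftrightarrow> inj_on \<sigma> (V - T) \<and> \<sigma> ` (V - T) \<subseteq> V - S \<and>
     (\<forall>v\<in>V - T. \<sigma> v = v \<or> (v, \<sigma> v) \<in> A)"

section \<open>Linkings versus vertex-disjoint paths\<close>

lemma set_vwalk_arcs: "set (vwalk_arcs p) = {(p ! i, p ! Suc i) | i. Suc i < length p}"
proof (induction p rule: vwalk_arcs.induct)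
  case (3 a b xs)
  have "{((a # b # xs) ! i, (a # b # xs) ! Suc i) | i. Suc i < length (a # b # xs)} =
      insert (a, b) {((b # xs) ! i, (b # xs) ! Suc i) | i. Suc i < length (b # xs)}" (is "?L = ?R")
  proof
    show "?L \<subseteq> ?R"
    proof
      fix e assume "e \<in> ?L"
      then obtain i where i: "e = ((a # b # xs) ! i, (a # b # xs) ! Suc i)"
        "Suc i < length (a # b # xs)" by blast
      then show "e \<in> ?R" by (cases i) auto
    qed
    show "?R \<subseteq> ?L" by (auto intro: exI[of _ 0] exI[of _ "Suc _"])
  qed
  then show ?case using 3 by simp
qed auto

text \<open>Each path is the orbit of a point of \<open>S\<close> up to its first visit to
  \<open>T\<close>. Since \<sigma> is injective and never enters \<open>S\<close>, two orbits that
  meet can be traced back to the same start at the same time.\<close>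

lemma disjoint_paths_if_linking:
  assumes "finite V" "V \<subseteq> pverts G" "S \<subseteq> V" and link: "linking V (parcs G) S T \<sigma>"
  shows "\<exists>P. finite P \<and> card P = card S \<and> disjoint_family_on set P \<and>
    (\<forall>p\<in>P. vpath p (with_proj G) \<and> hd p \<in> S \<and> last p \<in> T)"
proof -
  have inj: "inj_on \<sigma> (V - T)" and into: "\<And>v. v \<in> V - T \<Longrightarrow> \<sigma> v \<in> V - S"
    and arc: "\<And>v. v \<in> V - T \<Longrightarrow> \<sigma> v = v \<or> (v, \<sigma> v) \<in> parcs G"
    using link unfolding linking_def by blast+
  \<comment> \<open>Only the iterates before the \<open>n\<close>-th must avoid \<open>T\<close>;
    the \<open>n\<close>-th itself may lie in \<open>T\<close>. So \<sigma> is applied only where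
    the linking controls it.\<close>
  define live where "live s n \<longleftrightarrow> (\<forall>i<n. (\<sigma> ^^ i) s \<notin> T)" for s n
  have live_mono: "live s i" if "live s n" "i \<le> n" for s n i
    using that unfolding live_def by auto
  have orbit_in: "(\<sigma> ^^ n) s \<in> V" if "s \<in> S" "live s n" for s n
    using that(2)
  proof (induction n)
    case 0 then show ?case using that(1) assms(3) by auto
  next
    case (Suc n)
    then show ?case using into[of "(\<sigma> ^^ n) s"] unfolding live_def by (simp add: less_Suc_eq)
  qed
  have orbit_Suc: "(\<sigma> ^^ Suc n) s \<notin> S" if "s \<in> S" "live s (Suc n)" for s n
    using into[of "(\<sigma> ^^ n) s"] orbit_in[of s n] that unfolding live_def by auto
  \<comment> \<open>Cancel \<sigma> on both sides until one orbit is back at its start; the other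
    must be there too, as \<sigma> has no value in \<open>S\<close>.\<close>
  have orbit_eq: "s = s' \<and> i = j"
    if "s \<in> S" "s' \<in> S" "live s i" "live s' j" "(\<sigma> ^^ i) s = (\<sigma> ^^ j) s'" for s s' i j
    using that(3-5)
  proof (induction i arbitrary: j)
    case 0
    then show ?case using orbit_Suc[of s' "j - 1"] that(1,2) by (cases j) auto
  next
    case (Suc i)
    show ?case
    proof (cases j)
      case 0 then show ?thesis using Suc.prems orbit_Suc[of s i] that(1,2) by auto
    next
      case (Suc k)
      have lv: "live s i" "live s' k" using Suc.prems \<open>j = Suc k\<close> live_mono by auto
      have "(\<sigma> ^^ i) s \<in> V - T" "(\<sigma> ^^ k) s' \<in> V - T"
        using Suc.prems \<open>j = Suc k\<close> orbit_in lv that(1,2) unfolding live_def by auto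
      then have "(\<sigma> ^^ i) s = (\<sigma> ^^ k) s'" using Suc.prems(3) \<open>j = Suc k\<close> inj by (auto dest: inj_onD)
      then show ?thesis using Suc.IH[OF lv] \<open>j = Suc k\<close> by simp
    qed
  qed
  \<comment> \<open>An orbit that never meets \<open>T\<close> would be an injective sequence in the
    finite set \<open>V\<close>.\<close>
  have hits: "\<exists>n. (\<sigma> ^^ n) s \<in> T" if "s \<in> S" for s
  proof (rule ccontr)
    assume "\<not> ?thesis"
    then have lv: "live s n" for n unfolding live_def by simp
    have "inj (\<lambda>n. (\<sigma> ^^ n) s)" using orbit_eq lv that by (auto simp: inj_def)
    moreover have "range (\<lambda>n. (\<sigma> ^^ n) s) \<subseteq> V" using orbit_in lv that by auto
    ultimately show False using \<open>finite V\<close> finite_subset finite_imageD infinite_UNIV_nat by metis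
  qed
  define len where "len s = (LEAST n. (\<sigma> ^^ n) s \<in> T)" for s
  have len: "(\<sigma> ^^ len s) s \<in> T" "live s (len s)" if "s \<in> S" for s
    using LeastI_ex[OF hits[OF that]] not_less_Least unfolding len_def live_def by blast+
  define path where "path s = map (\<lambda>i. (\<sigma> ^^ i) s) [0..<Suc (len s)]" for s
  have set_path: "set (path s) = {(\<sigma> ^^ i) s | i. i \<le> len s}" for s
    unfolding path_def by (auto simp: less_Suc_eq_le simp del: upt_Suc)
  have hd_path: "hd (path s) = s" for s unfolding path_def by (simp add: hd_map del: upt_Suc)
  have last_path: "last (path s) = (\<sigma> ^^ len s) s" for s
    unfolding path_def by simp
  have disj: "set (path s) \<inter> set (path s') = {}" if "s \<in> S" "s' \<in> S" "s \<noteq> s'" for s s'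
  proof (rule ccontr)
    assume "set (path s) \<inter> set (path s') \<noteq> {}"
    then obtain i j where "i \<le> len s" "j \<le> len s'" "(\<sigma> ^^ i) s = (\<sigma> ^^ j) s'"
      unfolding set_path by auto
    then show False using orbit_eq[of s s' i j] live_mono len(2) that by metis
  qed
  have "vpath (path s) (with_proj G)" if s: "s \<in> S" for s
  proof
    show "distinct (path s)"
      using orbit_eq[OF s s] len(2)[OF s] live_mono unfolding path_def
      by (auto simp: distinct_map inj_on_def less_Suc_eq_le simp del: upt_Suc)
    show "vwalk (path s) (with_proj G)"
    proof
      show "set (path s) \<subseteq> verts (with_proj G)"
        using orbit_in[OF s] len(2)[OF s] live_mono assms(2) unfolding set_path by auto
      show "path s \<noteq> []" unfolding path_def by simp
      show "set (vwalk_arcs (path s)) \<subseteq> arcs_ends (with_proj G)"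
      proof
        fix e assume "e \<in> set (vwalk_arcs (path s))"
        then obtain i where i: "i < len s" "e = ((\<sigma> ^^ i) s, \<sigma> ((\<sigma> ^^ i) s))"
          unfolding set_vwalk_arcs path_def by (auto simp del: upt_Suc)
        have lv: "live s i" "live s (Suc i)" using live_mono[OF len(2)[OF s]] i by auto
        then have "(\<sigma> ^^ i) s \<in> V - T" using orbit_in s unfolding live_def by blast
        \<comment> \<open>A fixed point would make two positions of one orbit equal, so every step
          of a path is a genuine arc.\<close>
        moreover have "\<sigma> ((\<sigma> ^^ i) s) \<noteq> (\<sigma> ^^ i) s"
          using orbit_eq[OF s s lv(2,1)] by auto
        ultimately show "e \<in> arcs_ends (with_proj G)" using arc i by auto
      qed
    qed
  qed
  moreover have "inj_on path S" using hd_path by (metis inj_onI)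
  ultimately show ?thesis
    using hd_path last_path len(1) disj finite_subset[OF assms(3,1)]
    by (intro exI[of _ "path ` S"]) (auto simp: card_image disjoint_family_on_def, blast)
qed

text \<open>The converse: move along the paths and fix every vertex off them. As there are as many
  paths as points of \<open>S\<close>, every point of \<open>S\<close> starts a path, so no vertex
  of \<open>S\<close> is left as a fixed point outside \<open>T\<close>.\<close>

lemma linking_if_disjoint_paths:
  assumes P: "finite P" "card P = card S" "disjoint_family_on set P" "finite S"
    and path: "\<And>p. p \<in> P \<Longrightarrow> vpath p (with_proj G) \<and> hd p \<in> S \<and> last p \<in> T"
  shows "\<exists>\<sigma>. linking (pverts G) (parcs G) S T \<sigma>"
proof -
  have pne: "p \<noteq> []" and dist: "distinct p" and inV: "set p \<subseteq> pverts G"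
    and arcs: "\<And>i. Suc i < length p \<Longrightarrow> (p ! i, p ! Suc i) \<in> parcs G"
    if "p \<in> P" for p
    using path[OF that] unfolding vpath_def vwalk_def set_vwalk_arcs by auto
  have same: "p = q \<and> i = j"
    if "p \<in> P" "q \<in> P" "i < length p" "j < length q" "p ! i = q ! j" for p q i j
  proof -
    have "p = q" using that P(3) unfolding disjoint_family_on_def by (metis disjoint_iff nth_mem)
    then show ?thesis using that dist nth_eq_iff_index_eq by blast
  qed
  have "inj_on hd P"
    using same pne by (intro inj_onI) (metis hd_conv_nth length_greater_0_conv)
  then have "hd ` P = S"
    using P path by (intro card_subset_eq) (auto simp: card_image)
  then have S: "\<exists>p\<in>P. s = p ! 0" if "s \<in> S" for s using that pne by (auto simp: hd_conv_nth)
  have last: "p ! i \<in> T" if "p \<in> P" "i < length p" "\<not> Suc i < length p" for p i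
  proof -
    have "i = length p - 1" using that by simp
    then show ?thesis using path[OF that(1)] pne[OF that(1)] by (simp add: last_conv_nth)
  qed
  \<comment> \<open>Only positions with a successor count. By \<open>same\<close>, a vertex has at
    most one such position, so the description in \<sigma> is well defined.\<close>
  define on where "on v p i \<longleftrightarrow> p \<in> P \<and> Suc i < length p \<and> v = p ! i" for v p i
  define \<sigma> where "\<sigma> v = (if \<exists>p i. on v p i then THE w. \<exists>p i. on v p i \<and> w = p ! Suc i else v)" for v
  have \<sigma>_on: "\<sigma> v = p ! Suc i" if "on v p i" for v p i
  proof -
    have "p = q \<and> i = j" if "on v q j" for q j
      using that \<open>on v p i\<close> same[of p q i j] unfolding on_def by (simp add: Suc_lessD)
    then have "(THE w. \<exists>p i. on v p i \<and> w = p ! Suc i) = p ! Suc i"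
      using that by (intro the_equality) blast+
    then show ?thesis using that unfolding \<sigma>_def by auto
  qed
  \<comment> \<open>A path vertex without successor is a last vertex and lies in \<open>T\<close>;
    outside \<open>T\<close>, no successor thus means lying on no path.\<close>
  have \<sigma>_off: "\<sigma> v = v" "\<And>p i. p \<in> P \<Longrightarrow> i < length p \<Longrightarrow> v \<noteq> p ! i"
    if "v \<notin> T" "\<nexists>p i. on v p i" for v
    using that last unfolding \<sigma>_def on_def by auto
  have "inj_on \<sigma> (pverts G - T)"
  proof (rule inj_onI)
    fix u v assume uv: "u \<in> pverts G - T" "v \<in> pverts G - T" "\<sigma> u = \<sigma> v"
    consider p i q j where "on u p i" "on v q j" | p i where "on u p i" "\<nexists>q j. on v q j"
      | q j where "\<nexists>p i. on u p i" "on v q j" | "\<nexists>p i. on u p i" "\<nexists>q j. on v q j" by blast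
    then show "u = v"
    proof cases
      case 1
      then have "p ! Suc i = q ! Suc j" using uv \<sigma>_on by metis
      then show ?thesis using 1 same[of p q "Suc i" "Suc j"] unfolding on_def by auto
    next
      case 2
      then show ?thesis using uv \<sigma>_on[OF 2(1)] \<sigma>_off[of v] unfolding on_def by (metis DiffE)
    next
      case 3
      then show ?thesis using uv \<sigma>_on[OF 3(2)] \<sigma>_off[of u] unfolding on_def by (metis DiffE)
    next
      case 4
      then show ?thesis using uv \<sigma>_off(1) by (metis DiffE)
    qed
  qed
  moreover have "\<sigma> v \<in> pverts G - S \<and> (\<sigma> v = v \<or> (v, \<sigma> v) \<in> parcs G)" if v: "v \<in> pverts G - T" for v
  proof (cases "\<exists>p i. on v p i")
    case True
    then obtain p i where pi: "on v p i" by blast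
    then have p: "p \<in> P" "Suc i < length p" "v = p ! i" unfolding on_def by auto
    have "p ! Suc i \<notin> S"
    proof
      assume "p ! Suc i \<in> S"
      then obtain q where "q \<in> P" "p ! Suc i = q ! 0" using S by blast
      then show False using same[of p q "Suc i" 0] p pne by auto
    qed
    then show ?thesis using \<sigma>_on[OF pi] p arcs inV nth_mem by fastforce
  next
    case False
    then have "v \<notin> S" using S \<sigma>_off(2)[of v] v pne by fastforce
    then show ?thesis using \<sigma>_off(1)[of v] v False by auto
  qed
  ultimately show ?thesis unfolding linking_def by blast
qed

text \<open>A cycle cannot raise the level, so it stays on one level and consists of arcs of
  \<open>R\<close>. This allows a whole acyclic subgraph to be placed on a single level.\<close>

lemma acyclic_level_extension:
  fixes level :: "'v \<Rightarrow> nat"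
  assumes "acyclic R"
    and up: "\<And>u v. (u, v) \<in> R' \<Longrightarrow> level u < level v \<or> (u, v) \<in> R \<and> level u = level v"
  shows "acyclic R'"
proof -
  have "level u < level v \<or> (u, v) \<in> R\<^sup>+ \<and> level u = level v" if "(u, v) \<in> R'\<^sup>+" for u v
    using that
  proof induction
    case (base v) then show ?case using up by blast
  next
    case (step v w)
    then show ?case using up[OF step.hyps(2)] by (auto intro: trancl_into_trancl)
  qed
  then show ?thesis using assms(1) unfolding acyclic_def by blast
qed

section \<open>Transporting linkings and splicing in the inner graph\<close>

lemma linking_image:
  assumes link: "linking V A S T \<sigma>" and inj: "inj_on f V" and "S \<subseteq> V" "T \<subseteq> V"
  shows "linking (f ` V) (map_prod f f ` A) (f ` S) (f ` T) (f \<circ> \<sigma> \<circ> inv_into V f)"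
proof -
  have D: "f ` V - f ` T = f ` (V - T)" "f ` V - f ` S = f ` (V - S)"
    using inj assms(3,4) by (auto simp: inj_on_image_set_diff[symmetric] inj_on_def)
  have inv: "inv_into V f (f v) = v" if "v \<in> V" for v using inj that by simp
  have \<sigma>: "inj_on \<sigma> (V - T)" "\<And>v. v \<in> V - T \<Longrightarrow> \<sigma> v \<in> V - S"
    "\<And>v. v \<in> V - T \<Longrightarrow> \<sigma> v = v \<or> (v, \<sigma> v) \<in> A"
    using link unfolding linking_def by blast+
  show ?thesis unfolding linking_def D
  proof (intro conjI)
    show "inj_on (f \<circ> \<sigma> \<circ> inv_into V f) (f ` (V - T))"
    proof (rule inj_onI)
      fix a b assume a: "a \<in> f ` (V - T)" and b: "b \<in> f ` (V - T)"
        and eq: "(f \<circ> \<sigma> \<circ> inv_into V f) a = (f \<circ> \<sigma> \<circ> inv_into V f) b"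
      obtain u v where uv: "u \<in> V - T" "a = f u" "v \<in> V - T" "b = f v" using a b by blast
      then have "f (\<sigma> u) = f (\<sigma> v)" using eq inv by auto
      then have "\<sigma> u = \<sigma> v" using inj \<sigma>(2) uv by (meson DiffD1 inj_onD)
      then show "a = b" using \<sigma>(1) uv by (auto dest: inj_onD)
    qed
    show "(f \<circ> \<sigma> \<circ> inv_into V f) ` f ` (V - T) \<subseteq> f ` (V - S)"
      using \<sigma>(2) inv by auto
    show "\<forall>v\<in>f ` (V - T). (f \<circ> \<sigma> \<circ> inv_into V f) v = v \<or>
        (v, (f \<circ> \<sigma> \<circ> inv_into V f) v) \<in> map_prod f f ` A"
      using \<sigma>(3) inv by force
  qed
qed

lemma superconcentrator_paths:
  assumes "superconcentrator N G I J" "S \<subseteq> I" "T \<subseteq> J" "card S = card T"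
  shows "\<exists>P. finite P \<and> card P = card S \<and> disjoint_family_on set P \<and>
    (\<forall>p\<in>P. vpath p (with_proj G) \<and> hd p \<in> S \<and> last p \<in> T)"
  using assms by (simp add: superconcentrator_def)

text \<open>The arcs of \<sigma> from \<open>I\<close> to \<open>J\<close> join equally large sets
  \<open>S'\<close> and \<open>T'\<close>, and disjoint paths of \<open>H\<close> can replace them.
  These may pair \<open>S'\<close> with \<open>T'\<close> differently, which is harmless because a
  linking prescribes only the sets of ends.\<close>

lemma linking_splice:
  assumes outer: "linking V (A \<union> I \<times> J) S T \<sigma>" and "finite V" "S \<subseteq> V"
    and VI: "pverts H \<inter> V = I \<union> J" and "I \<inter> J = {}"
    and "S \<inter> J = {}" "T \<inter> I = {}"
    and super: "superconcentrator n H I J"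
    and io: "\<And>u v. (u, v) \<in> parcs H \<Longrightarrow> v \<notin> I \<and> u \<notin> J"
  shows "\<exists>\<tau>. linking (pverts H \<union> V) (parcs H \<union> A) S T \<tau>"
proof -
  have \<sigma>: "inj_on \<sigma> (V - T)" "\<And>v. v \<in> V - T \<Longrightarrow> \<sigma> v \<in> V - S"
    "\<And>v. v \<in> V - T \<Longrightarrow> \<sigma> v = v \<or> (v, \<sigma> v) \<in> A \<or> (v \<in> I \<and> \<sigma> v \<in> J)"
    using outer unfolding linking_def by blast+
  have IJ: "I \<subseteq> V" "J \<subseteq> V" "I \<subseteq> pverts H" "J \<subseteq> pverts H" using VI by auto
  have VI': "v \<in> I \<or> v \<in> J" if "v \<in> pverts H" "v \<in> V" for v using VI that by auto
  define S' where "S' = {v \<in> I. \<sigma> v \<in> J}"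
  define T' where "T' = \<sigma> ` S'"
  have S': "S' \<subseteq> I" "S' \<subseteq> V - T" and T': "T' \<subseteq> J"
    using IJ assms unfolding S'_def T'_def by auto
  have "card S' = card T'"
    unfolding T'_def using \<sigma>(1) S'(2) inj_on_subset by (metis card_image)
  then obtain P where "finite P" "card P = card S'" "disjoint_family_on set P"
    "\<forall>p\<in>P. vpath p (with_proj H) \<and> hd p \<in> S' \<and> last p \<in> T'"
    using superconcentrator_paths[OF super S'(1) T'] by auto
  then obtain \<rho> where \<rho>: "linking (pverts H) (parcs H) S' T' \<rho>"
    using linking_if_disjoint_paths[of P S' H T'] S'(2) \<open>finite V\<close> finite_subset by (metis finite_Diff)
  then have \<rho>: "inj_on \<rho> (pverts H - T')" "\<And>v. v \<in> pverts H - T' \<Longrightarrow> \<rho> v \<in> pverts H - S'"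
    "\<And>v. v \<in> pverts H - T' \<Longrightarrow> \<rho> v = v \<or> (v, \<rho> v) \<in> parcs H"
    unfolding linking_def by blast+
  \<comment> \<open>On \<open>D\<close>, the starts of the rerouted arcs and the interior of
    \<open>H\<close>, the linking \<rho> of \<open>H\<close> takes over; \<sigma> is kept on
    \<open>J\<close> and on the rest of \<open>I\<close>.\<close>
  define D where "D = S' \<union> (pverts H - I - J)"
  have D: "D \<subseteq> pverts H - T'" using S' T' IJ \<open>I \<inter> J = {}\<close> unfolding D_def by auto
  \<comment> \<open>No arc of \<open>H\<close> enters \<open>I\<close>. No arc leaves
    \<open>J\<close>, so \<rho> fixes the points of \<open>J - T'\<close>, and by injectivity
    nothing else is sent there.\<close>
  have \<rho>D: "\<rho> v \<in> (pverts H - I - J) \<union> T'" if v: "v \<in> D" for v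
  proof -
    have "\<rho> v \<notin> I" using \<rho>(2,3)[of v] D v io unfolding D_def by fastforce
    moreover have "\<rho> v \<notin> J - T'"
    proof
      assume J: "\<rho> v \<in> J - T'"
      then have "\<rho> v \<in> pverts H - T'" using IJ by auto
      then have "\<rho> (\<rho> v) = \<rho> v" using \<rho>(3) io J by blast
      then have "\<rho> v = v" using \<rho>(1) D v \<open>\<rho> v \<in> pverts H - T'\<close> by (meson inj_onD subsetD)
      then show False using J v S'(1) \<open>I \<inter> J = {}\<close> unfolding D_def by auto
    qed
    ultimately show ?thesis using \<rho>(2) D v by blast
  qed
  define \<tau> where "\<tau> v = (if v \<in> D then \<rho> v else \<sigma> v)" for v
  have rest: "v \<in> V - T - S'" if "v \<in> pverts H \<union> V - T" "v \<notin> D" for v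
    using that IJ unfolding D_def by auto
  \<comment> \<open>The values in \<open>T'\<close> are already taken by \<open>S'\<close>. This
    keeps the images of \<sigma> and \<rho> apart: \<rho> takes values in \<open>T'\<close> or
    outside \<open>V\<close>.\<close>
  have \<sigma>rest: "\<sigma> v \<in> V - S - T'" if "v \<in> V - T - S'" for v
    using that \<sigma>(1,2) S'(2) unfolding T'_def by (auto dest: inj_onD)
  have sep: "\<rho> u \<noteq> \<sigma> v" if "u \<in> D" "v \<in> V - T - S'" for u v
    using \<rho>D[OF that(1)] \<sigma>rest[OF that(2)] VI'[of "\<sigma> v"] by auto
  have "inj_on \<tau> (pverts H \<union> V - T)"
  proof (rule inj_onI)
    fix u v assume uv: "u \<in> pverts H \<union> V - T" "v \<in> pverts H \<union> V - T" "\<tau> u = \<tau> v"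
    show "u = v"
    proof (cases "u \<in> D"; cases "v \<in> D")
      assume "u \<in> D" "v \<in> D"
      then show ?thesis using uv(3) \<rho>(1) D unfolding \<tau>_def by (auto dest: inj_onD)
    next
      assume "u \<in> D" "v \<notin> D"
      then show ?thesis using uv(3) sep rest[OF uv(2)] unfolding \<tau>_def by auto
    next
      assume "u \<notin> D" "v \<in> D"
      then show ?thesis using uv(3) sep rest[OF uv(1)] unfolding \<tau>_def by metis
    next
      assume "u \<notin> D" "v \<notin> D"
      then show ?thesis using uv(3) \<sigma>(1) rest[OF uv(1)] rest[OF uv(2)] unfolding \<tau>_def
        by (auto dest: inj_onD)
    qed
  qed
  moreover have "\<tau> v \<in> pverts H \<union> V - S \<and> (\<tau> v = v \<or> (v, \<tau> v) \<in> parcs H \<union> A)"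
    if v: "v \<in> pverts H \<union> V - T" for v
  proof (cases "v \<in> D")
    case True
    have "\<rho> v \<notin> S"
    proof
      assume "\<rho> v \<in> S"
      then have "\<rho> v \<in> V" "\<rho> v \<notin> J" using \<open>S \<subseteq> V\<close> \<open>S \<inter> J = {}\<close> by auto
      then show False using \<rho>D[OF True] VI'[of "\<rho> v"] T' by auto
    qed
    then show ?thesis using True D \<rho>(2,3) unfolding \<tau>_def by auto
  next
    case False
    then have r: "v \<in> V - T - S'" using rest v by blast
    then have "\<not> (v \<in> I \<and> \<sigma> v \<in> J)" unfolding S'_def by blast
    then show ?thesis using r False \<sigma>(2,3)[of v] unfolding \<tau>_def by auto
  qed
  ultimately show ?thesis unfolding linking_def by blast
qed

lemma card_halves:
  fixes m :: nat
  assumes "Z \<subseteq> {1..2 * m}"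
  shows "card Z = (\<Sum>i=1..m. of_bool (i \<in> Z) + of_bool (i + m \<in> Z))"
proof -
  let ?f = "\<lambda>i. of_bool (i \<in> Z) :: nat"
  have "j \<in> (\<lambda>i. i + m) ` {1..m}" if "j \<in> {1..2 * m}" "j \<notin> {1..m}" for j
    using that by (intro image_eqI[of _ _ "j - m"]) auto
  then have split: "{1..2 * m} = {1..m} \<union> (\<lambda>i. i + m) ` {1..m}" by auto
  have "card Z = sum ?f {1..2 * m}"
    using assms by (simp add: of_bool_def sum.If_cases Int_absorb1)
  also have "\<dots> = sum ?f {1..m} + sum ?f ((\<lambda>i. i + m) ` {1..m})"
    unfolding split by (rule sum.union_disjoint) auto
  also have "sum ?f ((\<lambda>i. i + m) ` {1..m}) = (\<Sum>i=1..m. ?f (i + m))"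
    by (subst sum.reindex) (auto simp: inj_on_def)
  finally show ?thesis by (simp only: sum.distrib)
qed

subsection \<open>The outer layer of the construction\<close>

text \<open>Abstract names for the vertices of one layer of the recursion, so that its combinatorics
  is independent of the vertex type; an injective map places them in the actual graph.\<close>

datatype node = X nat | X' nat | Y' nat | Y nat

definition outer_arcs :: "nat \<Rightarrow> (nat \<times> nat) set \<Rightarrow> (node \<times> node) set" where
  "outer_arcs m E = {(X i, X' j) | i j. (i, j) \<in> E} \<union> {(Y' j, Y i) | i j. (i, j) \<in> E} \<union>
     (\<Union>i\<in>{1..m}. {(X' (i + m), Y' i), (X' (i + m), X' i), (X' i, Y' (i + m)), (Y' i, Y' (i + m))})"

text \<open>Inputs outside \<open>S\<close> and outputs outside \<open>T\<close> are left out. Hence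
  a Hall set contains no inputs other than those in \<open>S\<close>, and no path can use an
  unselected input or output.\<close>

definition outer_verts :: "nat \<Rightarrow> nat set \<Rightarrow> nat set \<Rightarrow> node set" where
  "outer_verts m S T = X ` S \<union> X' ` {1..2 * m} \<union> Y' ` {1..2 * m} \<union> Y ` T"

text \<open>The number, 0, 1 or 2, of neighbours of \<open>U\<close> in the \<open>i\<close>-th
  pair.\<close>

definition hits :: "nat \<Rightarrow> (nat \<times> nat) set \<Rightarrow> nat set \<Rightarrow> nat \<Rightarrow> nat" where
  "hits m E U i = of_bool (i \<in> E `` U) + of_bool (i + m \<in> E `` U)"

text \<open>Indicators for one pair: unprimed letters refer to index \<open>i\<close>, primed ones
  to \<open>i + m\<close>. Here \<open>a\<close>, \<open>b\<close> mark the Hall set among the nodes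
  \<open>X'\<close> and \<open>Y'\<close>, \<open>p\<close>, \<open>q\<close> mark its neighbourhood
  there, and \<open>u\<close>, \<open>v\<close> mark neighbours of \<open>U\<close> and
  \<open>V\<close>. The case \<open>a = 0\<close> is for Hall sets that meet no input of the inner
  graph; the case \<open>q = 1\<close> is for the others, which reach all its outputs.\<close>

lemma gadget_count_nat:
  fixes a a' b b' u u' v v' p p' q q' w :: nat
  assumes "a \<le> p" "a' \<le> p'" "b \<le> q" "b' \<le> q'" "u \<le> p" "u' \<le> p'"
    "v + b \<le> 1" "v' + b' \<le> 1" "a' \<le> p" "a' \<le> q" "a \<le> q'" "b \<le> q'"
    "p \<le> 1" "p' \<le> 1" "q \<le> 1" "q' \<le> 1"
  shows "\<lbrakk>a = 0; w \<le> u + u'; w \<le> v + v' + 1\<rbrakk> \<Longrightarrow> a + a' + b + b' + w \<le> p + p' + q + q'"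
    and "\<lbrakk>q = 1; w \<le> v + v'; w \<le> u + u' + 1\<rbrakk> \<Longrightarrow> a + a' + b + b' + w \<le> p + p' + q + q'"
proof -
  have cases01: "n = 0 \<or> n = 1" if "n \<le> 1" for n :: nat using that by auto
  have a: "a \<le> 1" "a' \<le> 1" "b \<le> 1" using assms by linarith+
  show "a + a' + b + b' + w \<le> p + p' + q + q'" if "a = 0" "w \<le> u + u'" "w \<le> v + v' + 1"
    using cases01[OF a(2)] cases01[OF assms(16)]
    by (elim disjE) (use assms that in linarith)+
  show "a + a' + b + b' + w \<le> p + p' + q + q'" if "q = 1" "w \<le> v + v'" "w \<le> u + u' + 1"
    using cases01[OF a(1)] cases01[OF a(2)] cases01[OF a(3)]
    by (elim disjE) (use assms that in linarith)+
qed

lemma gadget_count: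
  fixes a a' b b' u u' v v' p p' q q' :: bool
  assumes "a \<Longrightarrow> p" "a' \<Longrightarrow> p'" "b \<Longrightarrow> q" "b' \<Longrightarrow> q'" "u \<Longrightarrow> p" "u' \<Longrightarrow> p'"
    "v \<Longrightarrow> \<not> b" "v' \<Longrightarrow> \<not> b'" "a' \<Longrightarrow> p" "a' \<Longrightarrow> q" "a \<Longrightarrow> q'" "b \<Longrightarrow> q'"
  shows "\<not> a \<Longrightarrow> of_bool a + of_bool a' + of_bool b + of_bool b' +
      min (of_bool u + of_bool u') (of_bool v + of_bool v' + (1::nat)) \<le>
      of_bool p + of_bool p' + of_bool q + of_bool q'"
    and "q \<Longrightarrow> of_bool a + of_bool a' + of_bool b + of_bool b' +
      min (of_bool v + of_bool v') (of_bool u + of_bool u' + (1::nat)) \<le>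
      of_bool p + of_bool p' + of_bool q + of_bool q'"
proof -
  have le: "(of_bool P :: nat) \<le> of_bool Q" if "P \<Longrightarrow> Q" for P Q using that by simp
  have le1: "(of_bool P :: nat) \<le> 1" for P by simp
  have compl: "(of_bool P :: nat) + of_bool Q \<le> 1" if "P \<Longrightarrow> \<not> Q" for P Q using that by auto
  note facts = le[OF assms(1)] le[OF assms(2)] le[OF assms(3)] le[OF assms(4)] le[OF assms(5)]
    le[OF assms(6)] compl[OF assms(7)] compl[OF assms(8)] le[OF assms(9)] le[OF assms(10)]
    le[OF assms(11)] le[OF assms(12)] le1 le1 le1 le1
  show "of_bool a + of_bool a' + of_bool b + of_bool b' +
      min (of_bool u + of_bool u') (of_bool v + of_bool v' + (1::nat)) \<le>
      of_bool p + of_bool p' + of_bool q + of_bool q'" if "\<not> a"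
    by (rule gadget_count_nat(1)[OF facts _ min.cobounded1 min.cobounded2]) (use that in simp_all)
  show "of_bool a + of_bool a' + of_bool b + of_bool b' +
      min (of_bool v + of_bool v') (of_bool u + of_bool u' + (1::nat)) \<le>
      of_bool p + of_bool p' + of_bool q + of_bool q'" if q
    by (rule gadget_count_nat(2)[OF facts _ min.cobounded1 min.cobounded2]) (use that in simp_all)
qed
text \<open>A linking is a choice of distinct representatives, each vertex choosing itself or a
  successor outside the inputs. For a Hall set made of \<open>U\<close>, \<open>A\<close> and
  \<open>B\<close>, passing from the outputs adjacent to \<open>B\<close> to the set
  \<open>V\<close> of the other outputs in \<open>T\<close> makes Hall's condition a sum of
  inequalities over the pairs.\<close>

lemma outer_linking:
  assumes E: "E \<subseteq> {1..2 * m} \<times> {1..2 * m}" and S: "S \<subseteq> {1..2 * m}" and T: "T \<subseteq> {1..2 * m}"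
    and cut1: "\<And>U V. U \<subseteq> S \<Longrightarrow> V \<subseteq> T \<Longrightarrow>
      card U + card V \<le> card T + (\<Sum>i=1..m. min (hits m E U i) (hits m E V i + 1))"
    and cut2: "\<And>U V. U \<subseteq> S \<Longrightarrow> V \<subseteq> T \<Longrightarrow>
      card U + card V \<le> card T + (\<Sum>i=1..m. min (hits m E V i) (hits m E U i + 1))"
  shows "\<exists>\<sigma>. linking (outer_verts m S T) (outer_arcs m E \<union> (X' ` {1..m}) \<times> (Y' ` {1..m}))
    (X ` S) (Y ` T) \<sigma>"
proof -
  let ?V = "outer_verts m S T"
  let ?A = "outer_arcs m E \<union> (X' ` {1..m}) \<times> (Y' ` {1..m})"
  let ?N = "\<lambda>v. {w \<in> ?V - X ` S. w = v \<or> (v, w) \<in> ?A}"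
  have fin: "finite S" "finite T" using S T finite_subset by blast+
  then have finV: "finite ?V" unfolding outer_verts_def by simp
  have "card W \<le> card (\<Union>(?N ` W))" if W: "W \<subseteq> ?V - Y ` T" for W
  proof -
    define U where "U = {i. X i \<in> W}"
    define A where "A = {i. X' i \<in> W}"
    define B where "B = {i. Y' i \<in> W}"
    have W_eq: "W = X ` U \<union> X' ` A \<union> Y' ` B" and sub: "U \<subseteq> S" "A \<subseteq> {1..2 * m}" "B \<subseteq> {1..2 * m}"
      using W unfolding U_def A_def B_def outer_verts_def by auto
    define QA where "QA = E `` U \<union> A \<union> {i \<in> {1..m}. i + m \<in> A}"
    \<comment> \<open>The last set comes from the complete bipartite part: a single inner input in
      \<open>A\<close> reaches every inner output.\<close>
    define QB where "QB = B \<union> {i \<in> {1..m}. i + m \<in> A} \<union> (\<lambda>i. i + m) ` ({1..m} \<inter> (A \<union> B)) \<union>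
      {i \<in> {1..m}. A \<inter> {1..m} \<noteq> {}}"
    define QT where "QT = {t \<in> T. E `` {t} \<inter> B \<noteq> {}}"
    define V where "V = T - QT"
    have Q: "QA \<subseteq> {1..2 * m}" "QB \<subseteq> {1..2 * m}" "QT \<subseteq> T" "V \<subseteq> T"
      using sub E unfolding QA_def QB_def QT_def V_def by auto
    have fins: "finite U" "finite A" "finite B" "finite QA" "finite QB" "finite QT"
      using sub Q fin finite_subset[OF _ finite_atLeastAtMost] finite_subset by metis+
    have cardW: "card W = card U + card A + card B"
      unfolding W_eq using fins by (subst card_Un_disjoint; auto simp: card_image inj_on_def)+
    have "X' ` QA \<subseteq> \<Union>(?N ` W)"
    proof
      fix w assume "w \<in> X' ` QA"
      then obtain j where j: "w = X' j" "j \<in> QA" by blast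
      have w: "w \<in> ?V - X ` S" using j Q(1) unfolding outer_verts_def by auto
      consider i where "i \<in> U" "(i, j) \<in> E" | "j \<in> A" | "j \<in> {1..m}" "j + m \<in> A"
        using j(2) unfolding QA_def by blast
      then have "\<exists>v\<in>W. w = v \<or> (v, w) \<in> ?A"
      proof cases
        case 1
        then show ?thesis using j unfolding U_def outer_arcs_def by blast
      next
        case 2
        then show ?thesis using j unfolding A_def by blast
      next
        case 3
        then show ?thesis using j unfolding A_def outer_arcs_def by blast
      qed
      then show "w \<in> \<Union>(?N ` W)" using w by blast
    qed
    moreover have "Y' ` QB \<subseteq> \<Union>(?N ` W)"
    proof
      fix w assume "w \<in> Y' ` QB"
      then obtain j where j: "w = Y' j" "j \<in> QB" by blast
      have w: "w \<in> ?V - X ` S" using j Q(2) unfolding outer_verts_def by auto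
      consider "j \<in> B" | "j \<in> {1..m}" "j + m \<in> A" | i where "j = i + m" "i \<in> {1..m}" "i \<in> A"
        | i where "j = i + m" "i \<in> {1..m}" "i \<in> B" | i where "j \<in> {1..m}" "i \<in> {1..m}" "i \<in> A"
        using j(2) unfolding QB_def by blast
      then have "\<exists>v\<in>W. w = v \<or> (v, w) \<in> ?A"
      proof cases
        case 1
        then show ?thesis using j unfolding B_def by blast
      next
        case 2
        then show ?thesis using j unfolding A_def outer_arcs_def by blast
      next
        case 3
        then show ?thesis using j unfolding A_def outer_arcs_def by blast
      next
        case 4
        then show ?thesis using j unfolding B_def outer_arcs_def by blast
      next
        case 5
        then show ?thesis using j unfolding A_def by blast
      qed
      then show "w \<in> \<Union>(?N ` W)" using w by blast
    qed
    moreover have "Y ` QT \<subseteq> \<Union>(?N ` W)"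
      unfolding QT_def B_def outer_arcs_def outer_verts_def by blast
    ultimately have "card (X' ` QA \<union> Y' ` QB \<union> Y ` QT) \<le> card (\<Union>(?N ` W))"
      using finite_subset[of "\<Union>(?N ` W)" ?V] finV by (intro card_mono) auto
    moreover have "card (X' ` QA \<union> Y' ` QB \<union> Y ` QT) = card QA + card QB + card QT"
      using fins by (subst card_Un_disjoint; auto simp: card_image inj_on_def)+
    moreover have "card T = card V + card QT"
      using Q(3) fin(2) card_mono[OF fin(2) Q(3)] unfolding V_def by (simp add: card_Diff_subset fins(6))
    moreover have "card U + card V + card A + card B \<le> card T + card QA + card QB"
    proof -
      \<comment> \<open>By the choice of \<open>V\<close>, no neighbour of \<open>V\<close> lies in
        \<open>B\<close>; this is where large \<open>V\<close> forces \<open>B\<close> to be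
        small.\<close>
      have EV: "j \<notin> B" if "j \<in> E `` V" for j
        using that unfolding V_def QT_def by blast
      have EU: "j \<in> QA" if "j \<in> E `` U" for j
        using that unfolding QA_def by blast
      have halves: "card A + card B + (\<Sum>i=1..m. f i) \<le> card QA + card QB"
        if "\<And>i. i \<in> {1..m} \<Longrightarrow> of_bool (i \<in> A) + of_bool (i + m \<in> A) + of_bool (i \<in> B) + of_bool (i + m \<in> B) + f i
          \<le> of_bool (i \<in> QA) + of_bool (i + m \<in> QA) + of_bool (i \<in> QB) + of_bool (i + m \<in> QB)"
        for f :: "nat \<Rightarrow> nat"
        unfolding card_halves[OF sub(2)] card_halves[OF sub(3)] card_halves[OF Q(1)] card_halves[OF Q(2)]
          sum.distrib[symmetric] by (rule sum_mono) (use that in \<open>simp only: add.assoc\<close>)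
      have QA_mem: "j \<in> QA" if "j \<in> A" for j using that unfolding QA_def by blast
      have QB_mem: "j \<in> QB" if "j \<in> B" for j using that unfolding QB_def by blast
      have gadget: "i + m \<in> A \<Longrightarrow> i \<in> QA" "i + m \<in> A \<Longrightarrow> i \<in> QB" "i \<in> A \<Longrightarrow> i + m \<in> QB"
        "i \<in> B \<Longrightarrow> i + m \<in> QB" if "i \<in> {1..m}" for i
        using that unfolding QA_def QB_def by blast+
      show ?thesis
      \<comment> \<open>Whether the complete bipartite part is reached is a global alternative, and
        it decides which of the two cut conditions is used for all pairs.\<close>
      proof (cases "A \<inter> {1..m} = {}")
        case True
        have "card A + card B + (\<Sum>i=1..m. min (hits m E U i) (hits m E V i + 1)) \<le> card QA + card QB"
        proof (rule halves)
          fix i assume i: "i \<in> {1..m}"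
          have "i \<notin> A" using True i by blast
          then show "of_bool (i \<in> A) + of_bool (i + m \<in> A) + of_bool (i \<in> B) + of_bool (i + m \<in> B)
              + min (hits m E U i) (hits m E V i + 1)
            \<le> of_bool (i \<in> QA) + of_bool (i + m \<in> QA) + of_bool (i \<in> QB) + of_bool (i + m \<in> QB)"
            using gadget[OF i] QA_mem[of i] QA_mem[of "i + m"] QB_mem[of i] QB_mem[of "i + m"]
              EU[of i] EU[of "i + m"] EV[of i] EV[of "i + m"]
            unfolding hits_def by (intro gadget_count(1)) blast+
        qed
        then show ?thesis using cut1[OF sub(1) Q(4)] by linarith
      next
        case False
        have "card A + card B + (\<Sum>i=1..m. min (hits m E V i) (hits m E U i + 1)) \<le> card QA + card QB"
        proof (rule halves)
          fix i assume i: "i \<in> {1..m}"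
          have "i \<in> QB" using False i unfolding QB_def by blast
          then show "of_bool (i \<in> A) + of_bool (i + m \<in> A) + of_bool (i \<in> B) + of_bool (i + m \<in> B)
              + min (hits m E V i) (hits m E U i + 1)
            \<le> of_bool (i \<in> QA) + of_bool (i + m \<in> QA) + of_bool (i \<in> QB) + of_bool (i + m \<in> QB)"
            using gadget[OF i] QA_mem[of i] QA_mem[of "i + m"] QB_mem[of i] QB_mem[of "i + m"]
              EU[of i] EU[of "i + m"] EV[of i] EV[of "i + m"]
            unfolding hits_def by (intro gadget_count(2)) blast+
        qed
        then show ?thesis using cut2[OF sub(1) Q(4)] by linarith
      qed
    qed
    ultimately show ?thesis using cardW by linarith
  qed
  then obtain \<sigma> where "inj_on \<sigma> (?V - Y ` T)" "\<forall>v\<in>?V - Y ` T. \<sigma> v \<in> ?N v"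
    using hall_marriage[of "?V - Y ` T" ?N] finV by auto
  then show ?thesis unfolding linking_def by (intro exI[of _ \<sigma>]) auto
qed

subsection \<open>The cut inequality from expansion\<close>

lemma hits_sum:
  assumes "E \<subseteq> {1..2 * m} \<times> {1..2 * m}"
  shows "card (E `` U) = (\<Sum>i=1..m. hits m E U i)"
  using assms unfolding hits_def by (intro card_halves) auto

lemma pairs_hit:
  "card {q \<in> half_pairs (2 * m). E `` U \<inter> q \<noteq> {}} = (\<Sum>i=1..m. of_bool (hits m E U i \<noteq> 0))"
proof -
  have "{q \<in> half_pairs (2 * m). E `` U \<inter> q \<noteq> {}} =
      (\<lambda>i. {i, i + m}) ` {i \<in> {1..m}. hits m E U i \<noteq> 0}"
    unfolding half_pairs_def hits_def by auto
  moreover have "inj_on (\<lambda>i. {i, i + m}) {i \<in> {1..m}. hits m E U i \<noteq> 0}"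
    by (auto simp: inj_on_def doubleton_eq_iff)
  moreover have "(\<Sum>i=1..m. of_bool (Q i)) = card {i \<in> {1..m}. Q i}" for Q
    by (simp add: of_bool_def sum.If_cases Int_def)
  ultimately show ?thesis by (simp only: card_image)
qed

text \<open>On \<open>[C3, C5]\<close> the slope is 1, above the required 2/3. The bound at
  \<open>C5\<close> says that the last slope is at most 2/3, and since the last piece ends in
  \<open>[1, 1]\<close>, where equality holds, the bound extends to the whole piece.\<close>

lemma pw_linear_ge:
  assumes "C1 < C3" "C3 < C5" "C5 < 1" "C3 < t" "t \<le> 1"
    and "(C6 - C4) / (C5 - C3) = 1" "3 * C4 \<ge> 1 + 2 * C3"
  shows "3 * pw_linear C1 C2 C3 C4 C5 C6 t \<ge> 1 + 2 * t"
proof (cases "t \<le> C5")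
  case True
  then show ?thesis using assms unfolding pw_linear_def by simp
next
  case False
  define r where "r = (1 - C6) / (1 - C5)"
  have r: "r * (1 - C5) = 1 - C6" using assms unfolding r_def by auto
  have C6: "C6 = C4 + C5 - C3" using assms by (simp add: field_simps)
  then have "r * (1 - C5) \<le> 2 / 3 * (1 - C5)" using r assms by simp
  then have "r \<le> 2 / 3" using assms(3) mult_right_le_imp_le[of r "1 - C5" "2 / 3"] by simp
  then have "r * (1 - t) \<le> 2 / 3 * (1 - t)" using assms(5) by (intro mult_right_mono) auto
  moreover have "pw_linear C1 C2 C3 C4 C5 C6 t = C6 + r * (t - C5)"
    using False assms unfolding pw_linear_def r_def by simp
  then have "pw_linear C1 C2 C3 C4 C5 C6 t = 1 - r * (1 - t)"
    using r by (simp add: algebra_simps)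
  ultimately show ?thesis by simp
qed

text \<open>Allows both set sizes to be replaced by the smaller one, so that
  \<open>pw_linear_ge\<close> is needed at one argument only.\<close>

lemma pw_linear_mono:
  assumes "C1 < C3" "C3 < C5" "C5 < 1" "C6 \<le> 1" "C3 < s" "s \<le> t"
    and "(C6 - C4) / (C5 - C3) = 1"
  shows "pw_linear C1 C2 C3 C4 C5 C6 s \<le> pw_linear C1 C2 C3 C4 C5 C6 t"
proof -
  define r where "r = (1 - C6) / (1 - C5)"
  have r: "0 \<le> r" using assms unfolding r_def by simp
  have C6: "C6 = C4 + C5 - C3" using assms by (simp add: field_simps)
  have pw: "pw_linear C1 C2 C3 C4 C5 C6 a = (if a \<le> C5 then C4 + (a - C3) else C6 + r * (a - C5))"
    if "C3 < a" for a
    using that assms unfolding pw_linear_def r_def by simp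
  have "0 \<le> r * (t - C5)" if "C5 \<le> t" using that r by simp
  moreover have "r * (s - C5) \<le> r * (t - C5)" using r assms(6) by (simp add: mult_left_mono)
  ultimately show ?thesis using assms(5,6) C6 pw[of s] pw[of t] by (auto split: if_splits)
qed

text \<open>With the ratio \<open>card U / N\<close> as \<alpha>, the floor in the definition is
  exactly \<open>card U\<close>, so expansion applies to \<open>U\<close> itself.\<close>

lemma expander_card:
  assumes "expander N (real (card U) / real N) \<beta> E" "U \<subseteq> {1..N}" "U \<noteq> {}"
  shows "\<beta> * real N \<le> real (card (E `` U))"
proof -
  have "N \<noteq> 0" using assms(2,3) by auto
  then have "\<lceil>\<beta> * real N\<rceil> \<le> int (card (E `` U))" using assms unfolding expander_def by simp
  then show ?thesis by (simp add: ceiling_le_iff)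
qed

lemma pair_expander_card:
  assumes "pair_expander N (real (card U) / real N) 1 Q E" "U \<subseteq> {1..N}"
  shows "card U \<le> card {q \<in> Q. E `` U \<inter> q \<noteq> {}}"
proof (cases "N = 0")
  case True then show ?thesis using assms(2) by simp
next
  case False
  then show ?thesis using assms unfolding pair_expander_def by simp
qed

text \<open>The larger of \<open>card U\<close> and \<open>card V\<close> is at most
  \<open>k\<close>, so the sum has to pay only for the smaller one. If that one is at most
  \<open>C3 * N\<close>, it is paid for by pair expansion, otherwise by the bound on the piecewise
  linear function.\<close>

lemma expander_cut:
  fixes C1 C2 C3 C4 C5 C6 :: real
  assumes C: "0 < C3" "C1 < C3" "C3 < C5" "C5 < 1" "C6 \<le> 1" "(C6 - C4) / (C5 - C3) = 1"
      "3 * C4 \<ge> 1 + 2 * C3"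
    and E: "E \<subseteq> {1..2 * m} \<times> {1..2 * m}"
    and ex: "\<And>\<alpha>. \<alpha> \<in> {0..1} \<Longrightarrow> expander (2 * m) \<alpha> (pw_linear C1 C2 C3 C4 C5 C6 \<alpha>) E"
    and pair: "\<And>\<alpha>. \<alpha> \<in> {0..C3} \<Longrightarrow> pair_expander (2 * m) \<alpha> 1 (half_pairs (2 * m)) E"
    and U: "U \<subseteq> {1..2 * m}" and V: "V \<subseteq> {1..2 * m}" and k: "card U \<le> k" "card V \<le> k"
  shows "card U + card V \<le> k + (\<Sum>i=1..m. min (hits m E U i) (hits m E V i + 1))"
proof -
  let ?N = "2 * m"
  let ?u = "real (card U) / real ?N" and ?v = "real (card V) / real ?N"
  have pairs: "card W \<le> (\<Sum>i=1..m. of_bool (hits m E W i \<noteq> 0))"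
    if "W \<subseteq> {1..2 * m}" "real (card W) / real ?N \<le> C3" for W
    using pair_expander_card[OF pair that(1)] that(2) unfolding pairs_hit by simp
  \<comment> \<open>A pair met by \<open>W\<close> is met by \<open>U\<close>, and then both
    arguments of the minimum are at least 1.\<close>
  have min_ge: "(\<Sum>i=1..m. of_bool (hits m E W i \<noteq> 0)) \<le>
      (\<Sum>i=1..m. min (hits m E U i) (hits m E V i + 1))" if "W \<subseteq> U" for W
    using that by (intro sum_mono) (auto simp: hits_def)
  consider "?u \<le> C3" | "?v \<le> C3" "card V \<le> card U" | "C3 < ?u" "C3 < ?v"
  proof -
    have "?v \<le> ?u" if "card V \<le> card U" using that by (intro divide_right_mono) auto
    moreover have "?u \<le> ?v" if "card U \<le> card V" using that by (intro divide_right_mono) auto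
    ultimately show ?thesis using that by linarith
  qed
  then show ?thesis
  proof cases
    case 1
    then show ?thesis using pairs[OF U] min_ge[of U] k(2) by simp
  next
    case 2
    \<comment> \<open>The sum counts pairs met by \<open>U\<close>, not by \<open>V\<close>, so pair
      expansion is applied to a part of \<open>U\<close> of the size of \<open>V\<close>.\<close>
    obtain W where W: "W \<subseteq> U" "card W = card V" using 2(2) obtain_subset_with_card_n by metis
    then have "card V \<le> (\<Sum>i=1..m. of_bool (hits m E W i \<noteq> 0))"
      using pairs[of W] U 2(1) by auto
    then show ?thesis using min_ge[OF W(1)] k(1) by simp
  next
    case 3
    let ?e = "pw_linear C1 C2 C3 C4 C5 C6"
    have ne: "U \<noteq> {}" "V \<noteq> {}" using 3 C(1) by auto
    then have m: "0 < m" using U by (cases m) auto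
    have le1: "?u \<le> 1" "?v \<le> 1" using card_mono[OF _ U] card_mono[OF _ V] m by auto
    have eu: "?e ?u * real ?N \<le> real (card (E `` U))"
      using ex[of ?u] le1 U ne(1) by (intro expander_card) auto
    have ev: "?e ?v * real ?N \<le> real (card (E `` V))"
      using ex[of ?v] le1 V ne(2) by (intro expander_card) auto
    define t where "t = min ?u ?v"
    have t: "C3 < t" "t \<le> 1" "t \<le> ?u" "t \<le> ?v" using 3 le1 unfolding t_def by auto
    have "?e t \<le> ?e ?u" "?e t \<le> ?e ?v"
      using pw_linear_mono[OF C(2-5) t(1) _ C(6)] t(3,4) by auto
    then have "1 + 2 * t \<le> 2 * ?e ?u + ?e ?v"
      using pw_linear_ge[OF C(2-4) t(1,2) C(6,7), of C2] by linarith
    then have "(1 + 2 * t) * real ?N \<le> (2 * ?e ?u + ?e ?v) * real ?N" by (intro mult_right_mono) auto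
    then have "real ?N + 2 * (t * real ?N) \<le> 2 * (?e ?u * real ?N) + ?e ?v * real ?N"
      by (simp only: algebra_simps)
    moreover have "t * real ?N = real (min (card U) (card V))"
      using m unfolding t_def by (auto simp: min_def field_simps)
    ultimately have main: "2 * m + 2 * min (card U) (card V) \<le> 2 * card (E `` U) + card (E `` V)"
      using eu ev by linarith
    \<comment> \<open>Valid because both counts are at most 2; equality occurs for instance at
      counts 2 and 0. Summed over the \<open>m\<close> pairs, the constant gives the
      \<open>2 * m\<close> that cancels in \<open>main\<close>.\<close>
    have "2 * hits m E U i + hits m E V i \<le> 2 * min (hits m E U i) (hits m E V i + 1) + 2" for i
      unfolding hits_def by (simp add: min_def of_bool_def)
    then have "(\<Sum>i=1..m. 2 * hits m E U i + hits m E V i) \<le>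
        (\<Sum>i=1..m. 2 * min (hits m E U i) (hits m E V i + 1) + 2)" by (intro sum_mono)
    then have "2 * card (E `` U) + card (E `` V) \<le>
        2 * (\<Sum>i=1..m. min (hits m E U i) (hits m E V i + 1)) + 2 * m"
      unfolding hits_sum[OF E] by (simp only: sum.distrib sum_constant flip: sum_distrib_left) simp
    then show ?thesis using main k by linarith
  qed
qed

subsection \<open>The recursion step\<close>

lemma outer_arcs_nodes:
  assumes "E \<subseteq> {1..2 * m} \<times> {1..2 * m}" "(a, b) \<in> outer_arcs m E"
  shows "a \<in> outer_verts m {1..2 * m} {1..2 * m} - range Y"
    and "b \<in> outer_verts m {1..2 * m} {1..2 * m} - range X"
  using assms unfolding outer_arcs_def outer_verts_def by auto

text \<open>The inner inputs and outputs share level 2 because the whole inner graph will be placed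
  there; arcs between them are not outer arcs.\<close>

fun node_level :: "nat \<Rightarrow> node \<Rightarrow> nat" where
  "node_level m (X i) = 0"
| "node_level m (X' i) = (if i \<in> {1..m} then 2 else 1)"
| "node_level m (Y' i) = (if i \<in> {1..m} then 2 else 3)"
| "node_level m (Y i) = 4"

lemma node_level_less: "(a, b) \<in> outer_arcs m E \<Longrightarrow> node_level m a < node_level m b"
  unfolding outer_arcs_def by auto

text \<open>The linking of the abstract layer is transported by \<open>f\<close>, spliced with
  \<open>H\<close> and unfolded into paths. The second conclusion, that inputs are sources and
  outputs are sinks, is what the splicing at the next level requires.\<close>

lemma superconcentrator_step:
  fixes m :: nat and H G :: "'v pair_pre_digraph" and f :: "node \<Rightarrow> 'v"
  defines "V\<^sub>1 \<equiv> outer_verts m {1..2 * m} {1..2 * m}"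
    and "I \<equiv> f ` X' ` {1..m}" and "J \<equiv> f ` Y' ` {1..m}"
  assumes E: "E \<subseteq> {1..2 * m} \<times> {1..2 * m}"
    and super: "superconcentrator m H I J"
    and io: "\<And>u v. (u, v) \<in> parcs H \<Longrightarrow> v \<notin> I \<and> u \<notin> J"
    and inj: "inj_on f V\<^sub>1" and inter: "pverts H \<inter> f ` V\<^sub>1 = I \<union> J"
    and G: "pverts G = pverts H \<union> f ` V\<^sub>1" "parcs G = parcs H \<union> map_prod f f ` outer_arcs m E"
    and cut: "\<And>U V k. U \<subseteq> {1..2 * m} \<Longrightarrow> V \<subseteq> {1..2 * m} \<Longrightarrow> card U \<le> k \<Longrightarrow> card V \<le> k \<Longrightarrow>
      card U + card V \<le> k + (\<Sum>i=1..m. min (hits m E U i) (hits m E V i + 1))"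
  shows "superconcentrator (2 * m) G (f ` X ` {1..2 * m}) (f ` Y ` {1..2 * m})"
    and "\<And>u v. (u, v) \<in> parcs G \<Longrightarrow> v \<notin> f ` X ` {1..2 * m} \<and> u \<notin> f ` Y ` {1..2 * m}"
proof -
  have H: "pair_fin_digraph H" "acyclic (parcs H)" using super unfolding superconcentrator_def by auto
  interpret H: pair_fin_digraph H by fact
  have H_arc: "u \<in> pverts H" "v \<in> pverts H" if "(u, v) \<in> parcs H" for u v
    using H.arc_fst_in_verts[OF that] H.arc_snd_in_verts[OF that] by auto
  have V\<^sub>1: "X i \<in> V\<^sub>1" "X' i \<in> V\<^sub>1" "Y' i \<in> V\<^sub>1" "Y i \<in> V\<^sub>1" if "i \<in> {1..2 * m}" for i
    using that unfolding V\<^sub>1_def outer_verts_def by auto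
  have finV: "finite V\<^sub>1" unfolding V\<^sub>1_def outer_verts_def by simp
  have f_eq: "f a = f b \<longleftrightarrow> a = b" if "a \<in> V\<^sub>1" "b \<in> V\<^sub>1" for a b
    using inj that by (auto dest: inj_onD)
  have f_H: "f a \<in> pverts H \<longleftrightarrow> a \<in> X' ` {1..m} \<union> Y' ` {1..m}" if a: "a \<in> V\<^sub>1" for a
  proof -
    have sub: "X' ` {1..m} \<union> Y' ` {1..m} \<subseteq> V\<^sub>1" using V\<^sub>1 by auto
    have "f a \<in> pverts H \<longleftrightarrow> f a \<in> pverts H \<inter> f ` V\<^sub>1" using a by simp
    also have "\<dots> \<longleftrightarrow> f a \<in> f ` (X' ` {1..m} \<union> Y' ` {1..m})"
      unfolding inter I_def J_def image_Un ..
    finally show ?thesis using inj_on_image_mem_iff[OF inj a sub] by simp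
  qed
  have outer: "a \<in> V\<^sub>1 - range Y" "b \<in> V\<^sub>1 - range X" if "(a, b) \<in> outer_arcs m E" for a b
    using outer_arcs_nodes[OF E that] unfolding V\<^sub>1_def by auto
  show "v \<notin> f ` X ` {1..2 * m} \<and> u \<notin> f ` Y ` {1..2 * m}" if uv: "(u, v) \<in> parcs G" for u v
  proof (cases "(u, v) \<in> parcs H")
    case True
    then show ?thesis using H_arc f_H V\<^sub>1 by blast
  next
    case False
    then obtain a b where ab: "(a, b) \<in> outer_arcs m E" "u = f a" "v = f b"
      using uv unfolding G by auto
    have "f b \<noteq> f (X i)" "f a \<noteq> f (Y i)" if "i \<in> {1..2 * m}" for i
      using outer[OF ab(1)] V\<^sub>1[OF that] f_eq by auto
    then show ?thesis unfolding ab by blast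
  qed
  have "pair_fin_digraph G"
  proof
    show "fst e \<in> pverts G" "snd e \<in> pverts G" if "e \<in> parcs G" for e
      using that H_arc outer unfolding G by force+
    show "finite (pverts G)" using H.pair_finite_verts finV unfolding G by simp
    have "outer_arcs m E \<subseteq> V\<^sub>1 \<times> V\<^sub>1" using outer by auto
    then show "finite (parcs G)"
      using H.pair_finite_arcs finV finite_subset unfolding G by (metis finite_SigmaI finite_Un finite_imageI)
  qed
  moreover have "acyclic (parcs G)"
  proof (rule acyclic_level_extension[OF H(2)])
    \<comment> \<open>The value 2 on \<open>H\<close> agrees with \<open>node_level\<close> on the
      shared vertices.\<close>
    define level where "level v = (if v \<in> pverts H then 2 else node_level m (inv_into V\<^sub>1 f v))" for v
    have level: "level (f a) = node_level m a" if "a \<in> V\<^sub>1" for a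
      using f_H[OF that] inj that unfolding level_def by auto
    fix u v assume "(u, v) \<in> parcs G"
    then consider "(u, v) \<in> parcs H" | a b where "(a, b) \<in> outer_arcs m E" "u = f a" "v = f b"
      unfolding G by auto
    then show "level u < level v \<or> (u, v) \<in> parcs H \<and> level u = level v"
    proof cases
      case 1
      then show ?thesis using H_arc unfolding level_def by auto
    next
      case 2
      then show ?thesis using node_level_less[OF 2(1)] outer[OF 2(1)] level by auto
    qed
  qed
  moreover have "f ` X ` {1..2 * m} \<subseteq> pverts G" "f ` Y ` {1..2 * m} \<subseteq> pverts G"
    using V\<^sub>1 unfolding G by auto
  moreover have "f ` X ` {1..2 * m} \<inter> f ` Y ` {1..2 * m} = {}"
    using f_eq V\<^sub>1 by force
  moreover have card: "card (f ` X ` S) = card S" "card (f ` Y ` S) = card S" if "S \<subseteq> {1..2 * m}" for S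
  proof -
    have "inj_on (f \<circ> X) S" "inj_on (f \<circ> Y) S"
      using that f_eq V\<^sub>1 unfolding inj_on_def by (auto simp: subset_iff)
    then show "card (f ` X ` S) = card S" "card (f ` Y ` S) = card S"
      by (metis card_image image_comp)+
  qed
  moreover have "\<exists>P. finite P \<and> card P = card S \<and> disjoint_family_on set P \<and>
      (\<forall>p\<in>P. vpath p (with_proj G) \<and> hd p \<in> S \<and> last p \<in> T)"
    if ST: "S \<subseteq> f ` X ` {1..2 * m}" "T \<subseteq> f ` Y ` {1..2 * m}" "card S = card T" for S T
  proof -
    obtain S\<^sub>0 where S: "S\<^sub>0 \<subseteq> {1..2 * m}" "S = f ` X ` S\<^sub>0"
      using ST(1) by (metis subset_image_iff)
    obtain T\<^sub>0 where T: "T\<^sub>0 \<subseteq> {1..2 * m}" "T = f ` Y ` T\<^sub>0"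
      using ST(2) by (metis subset_image_iff)
    have k: "card S\<^sub>0 = card T\<^sub>0" using ST(3) S T card by simp
    have fin: "finite S\<^sub>0" "finite T\<^sub>0" using S(1) T(1) finite_subset by blast+
    define V where "V = outer_verts m S\<^sub>0 T\<^sub>0"
    have V: "V \<subseteq> V\<^sub>1" using S(1) T(1) unfolding V_def V\<^sub>1_def outer_verts_def by auto
    have XV: "X ` S\<^sub>0 \<subseteq> V" "Y ` T\<^sub>0 \<subseteq> V" "X' ` {1..m} \<subseteq> V" "Y' ` {1..m} \<subseteq> V"
      unfolding V_def outer_verts_def by auto
    let ?A = "outer_arcs m E"
    have le: "card U \<le> card T\<^sub>0" if "U \<subseteq> S\<^sub>0 \<or> U \<subseteq> T\<^sub>0" for U
      using that k fin card_mono by metis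
    have "\<exists>\<sigma>. linking V (?A \<union> (X' ` {1..m}) \<times> (Y' ` {1..m})) (X ` S\<^sub>0) (Y ` T\<^sub>0) \<sigma>"
      unfolding V_def
    proof (rule outer_linking[OF E S(1) T(1)])
      fix U W assume UW: "U \<subseteq> S\<^sub>0" "W \<subseteq> T\<^sub>0"
      then have *: "U \<subseteq> {1..2 * m}" "W \<subseteq> {1..2 * m}" "card U \<le> card T\<^sub>0" "card W \<le> card T\<^sub>0"
        using S(1) T(1) le by auto
      show "card U + card W \<le> card T\<^sub>0 + (\<Sum>i=1..m. min (hits m E U i) (hits m E W i + 1))"
        using cut * by blast
      \<comment> \<open>Input and output sides carry the same edge set, so the second condition is
        the first with the two sets exchanged.\<close>
      show "card U + card W \<le> card T\<^sub>0 + (\<Sum>i=1..m. min (hits m E W i) (hits m E U i + 1))"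
        using cut[OF *(2,1,4,3)] by (simp only: add.commute)
    qed
    then obtain \<sigma> where "linking (f ` V) (map_prod f f ` (?A \<union> (X' ` {1..m}) \<times> (Y' ` {1..m}))) S T \<sigma>"
      using linking_image[OF _ inj_on_subset[OF inj V] XV(1,2)] unfolding S(2) T(2) by blast
    moreover have "map_prod f f ` (?A \<union> (X' ` {1..m}) \<times> (Y' ` {1..m})) = map_prod f f ` ?A \<union> I \<times> J"
      unfolding image_Un I_def J_def by (simp only: map_prod_surj_on[OF refl refl])
    ultimately have link: "linking (f ` V) (map_prod f f ` ?A \<union> I \<times> J) S T \<sigma>" by simp
    have "\<exists>\<tau>. linking (pverts H \<union> f ` V) (parcs H \<union> map_prod f f ` ?A) S T \<tau>"
    proof (rule linking_splice[OF link _ _ _ _ _ _ super io])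
      show "finite (f ` V)" using finV V finite_subset by blast
      show "S \<subseteq> f ` V" using S(2) XV by auto
      have "I \<union> J \<subseteq> f ` V" using XV(3,4) unfolding I_def J_def by blast
      then show "pverts H \<inter> f ` V = I \<union> J" using inter V by blast
      show "I \<inter> J = {}" using super unfolding superconcentrator_def by blast
      have IJ: "I \<union> J \<subseteq> pverts H" using inter by blast
      have "S \<inter> pverts H = {}" using S V\<^sub>1 f_H by blast
      then show "S \<inter> J = {}" using IJ by blast
      have "T \<inter> pverts H = {}" using T V\<^sub>1 f_H by blast
      then show "T \<inter> I = {}" using IJ by blast
    qed
    then obtain \<tau> where "linking (pverts H \<union> f ` V) (parcs G) S T \<tau>" unfolding G by blast
    moreover have "finite (pverts H \<union> f ` V)"
      using H.pair_finite_verts finV V finite_subset by blast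
    moreover have "pverts H \<union> f ` V \<subseteq> pverts G" using V unfolding G by blast
    moreover have "S \<subseteq> pverts H \<union> f ` V" using S(2) XV by auto
    ultimately show ?thesis by (intro disjoint_paths_if_linking)
  qed
  ultimately show "superconcentrator (2 * m) G (f ` X ` {1..2 * m}) (f ` Y ` {1..2 * m})"
    unfolding superconcentrator_def by simp
qed

theorem theorem2p2:
  fixes C1 C2 C3 C4 C5 C6 :: real
    and E :: "nat \<Rightarrow> (nat \<times> nat) set"
    and N\<^sub>0 N :: nat
    and G :: "'v pair_pre_digraph"
    and x y :: "nat \<Rightarrow> 'v"
  assumes "{C1, C2, C3, C4, C5, C6} \<subseteq> {0<..<1}"
    and "C1 < C3" and "C3 < C5"
    and "C2 + C4 \<ge> 1"
    and "C1 + C2 + C3 \<le> 1"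
    and "C2 / C1 > (C4 - C2) / (C3 - C1)"
    and "(C4 - C2) / (C3 - C1) > (C6 - C4) / (C5 - C3)"
    and "(C6 - C4) / (C5 - C3) = 1"
    and "1 > (1 - C6) / (1 - C5)"
    and "\<And>M. bipartite_edges M (E M)"
    and "\<And>M \<alpha>. \<alpha> \<in> {0..1} \<Longrightarrow> expander M \<alpha> (pw_linear C1 C2 C3 C4 C5 C6 \<alpha>) (E M)"
    and "\<And>M \<alpha>. even M \<Longrightarrow> \<alpha> \<in> {0..C3} \<Longrightarrow> pair_expander M \<alpha> 1 (half_pairs M) (E M)"
    and "Gamma E N\<^sub>0 N G x y"
  shows "superconcentrator N G (x ` {1..N}) (y ` {1..N})"
proof -
  have C: "0 < C3" "C5 < 1" "C6 \<le> 1" using assms(1) by auto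
  \<comment> \<open>The slope on \<open>[C1, C3]\<close> exceeds the next slope, which is 1.\<close>
  have "C3 - C1 < C4 - C2" using assms(2,7,8) by (simp add: less_divide_eq)
  then have C34: "3 * C4 \<ge> 1 + 2 * C3" using assms(4,5) by linarith
  \<comment> \<open>The induction also carries that inputs have no incoming and outputs no outgoing
    arcs.\<close>
  have "superconcentrator N G (x ` {1..N}) (y ` {1..N}) \<and>
      (\<forall>u v. (u, v) \<in> parcs G \<longrightarrow> v \<notin> x ` {1..N} \<and> u \<notin> y ` {1..N})"
    using assms(13)
  proof induction
    case (base N G x y)
    then show ?case by blast
  next
    case (step N H x' y' x y)
    define m where "m = N div 2"
    have N: "N = 2 * m" using step.hyps(2) unfolding m_def by simp
    define f where "f = case_node x x' y' y"
    have f: "f (X i) = x i" "f (X' i) = x' i" "f (Y' i) = y' i" "f (Y i) = y i" for i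
      unfolding f_def by simp_all
    have fim: "f ` X ` K = x ` K" "f ` X' ` K = x' ` K" "f ` Y' ` K = y' ` K" "f ` Y ` K = y ` K" for K
      unfolding image_image f by simp_all
    have E: "E N \<subseteq> {1..2 * m} \<times> {1..2 * m}"
      using assms(10)[of N] unfolding bipartite_edges_def N .
    let ?V = "outer_verts m {1..2 * m} {1..2 * m}"
    have fV: "f ` ?V = x ` {1..N} \<union> x' ` {1..N} \<union> y' ` {1..N} \<union> y ` {1..N}"
      unfolding outer_verts_def N by (simp only: image_Un fim)
    have upt: "set [1..<Suc N] = {1..N}" by auto
    have dist: "inj_on x {1..N}" "inj_on y {1..N}" "inj_on x' {1..N}" "inj_on y' {1..N}"
      "x ` {1..N} \<inter> y ` {1..N} = {}" "x ` {1..N} \<inter> x' ` {1..N} = {}" "x ` {1..N} \<inter> y' ` {1..N} = {}"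
      "y ` {1..N} \<inter> x' ` {1..N} = {}" "y ` {1..N} \<inter> y' ` {1..N} = {}" "x' ` {1..N} \<inter> y' ` {1..N} = {}"
      using step.hyps(4) unfolding distinct_append distinct_map set_append set_map upt Int_Un_distrib Un_empty
      by (simp_all only: simp_thms)
    have inj: "inj_on f ?V"
    proof (rule inj_onI)
      fix a b assume ab: "a \<in> ?V" "b \<in> ?V" "f a = f b"
      have mem: "X i \<in> ?V \<longleftrightarrow> i \<in> {1..N}" "X' i \<in> ?V \<longleftrightarrow> i \<in> {1..N}"
          "Y' i \<in> ?V \<longleftrightarrow> i \<in> {1..N}" "Y i \<in> ?V \<longleftrightarrow> i \<in> {1..N}" for i
        unfolding outer_verts_def N by auto
      have ne: "p i \<noteq> q j" "q j \<noteq> p i"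
        if "p ` {1..N} \<inter> q ` {1..N} = {}" "i \<in> {1..N}" "j \<in> {1..N}"
        for p q :: "nat \<Rightarrow> 'v" and i j
        using that(2,3) disjoint_iff[THEN iffD1, OF that(1)] by force+
      show "a = b"
        using ab by (cases a; cases b)
          (simp_all only: f mem ne[OF dist(5)] ne[OF dist(6)] ne[OF dist(7)] ne[OF dist(8)]
            ne[OF dist(9)] ne[OF dist(10)] dist(1-4)[THEN inj_on_eq_iff])
    qed
    have IH: "superconcentrator m H (f ` X' ` {1..m}) (f ` Y' ` {1..m})"
      "\<And>u v. (u, v) \<in> parcs H \<Longrightarrow> v \<notin> f ` X' ` {1..m} \<and> u \<notin> f ` Y' ` {1..m}"
      using step.IH unfolding fim m_def by blast+
    \<comment> \<open>Freshness of the other listed vertices leaves only the \<open>x' i\<close> and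
      \<open>y' i\<close> with \<open>i \<le> m\<close> in common.\<close>
    have inter: "pverts H \<inter> f ` ?V = f ` X' ` {1..m} \<union> f ` Y' ` {1..m}"
    proof -
      have split: "{1..N} = {1..m} \<union> {m<..N}" unfolding N by auto
      have sub: "x' ` {1..m} \<subseteq> pverts H" "y' ` {1..m} \<subseteq> pverts H"
        using IH(1) unfolding superconcentrator_def fim by (simp_all only: simp_thms)
      have new: "x ` {1..N} \<inter> pverts H = {}" "y ` {1..N} \<inter> pverts H = {}"
        "x' ` {m<..N} \<inter> pverts H = {}" "y' ` {m<..N} \<inter> pverts H = {}"
        using step.hyps(5) unfolding m_def[symmetric] Int_Un_distrib2 Un_empty
        by (simp_all only: simp_thms)
      have halves: "x' ` {1..N} = x' ` {1..m} \<union> x' ` {m<..N}" "y' ` {1..N} = y' ` {1..m} \<union> y' ` {m<..N}"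
        by (simp_all only: split image_Un)
      have "P \<inter> (A \<union> (B \<union> B') \<union> (D \<union> D') \<union> F) = B \<union> D"
        if "A \<inter> P = {}" "F \<inter> P = {}" "B' \<inter> P = {}" "D' \<inter> P = {}" "B \<subseteq> P" "D \<subseteq> P"
        for P A B B' D D' F :: "'v set"
        using that by auto
      from this[OF new sub] show ?thesis unfolding fV fim halves .
    qed
    let ?G = "\<lparr>pverts = pverts H \<union> x ` {1..N} \<union> y ` {1..N} \<union> x' ` {1..N} \<union> y' ` {1..N},
       parcs = parcs H
         \<union> {(x i, x' j) | i j. (i, j) \<in> E N}
         \<union> {(y' j, y i) | i j. (i, j) \<in> E N}
         \<union> (\<Union>i\<in>{1..N div 2}.
              {(x' (i + N div 2), y' i), (x' (i + N div 2), x' i),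
               (x' i, y' (i + N div 2)), (y' i, y' (i + N div 2))})\<rparr>"
    have verts: "pverts ?G = pverts H \<union> f ` ?V" unfolding fV by auto
    have "map_prod f f ` outer_arcs m (E N) = {(x i, x' j) | i j. (i, j) \<in> E N}
         \<union> {(y' j, y i) | i j. (i, j) \<in> E N}
         \<union> (\<Union>i\<in>{1..m}. {(x' (i + m), y' i), (x' (i + m), x' i), (x' i, y' (i + m)), (y' i, y' (i + m))})"
    proof -
      have "map_prod f f ` {(X i, X' j) | i j. (i, j) \<in> E N} = {(x i, x' j) | i j. (i, j) \<in> E N}"
        "map_prod f f ` {(Y' j, Y i) | i j. (i, j) \<in> E N} = {(y' j, y i) | i j. (i, j) \<in> E N}"
        by (force simp: f)+
      then show ?thesis
        unfolding outer_arcs_def image_Un image_UN by (simp only: image_insert image_empty map_prod_simp f)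
    qed
    then have arcs: "parcs ?G = parcs H \<union> map_prod f f ` outer_arcs m (E N)"
      unfolding m_def by (simp add: Un_assoc)
    have cut: "card U + card V \<le> k + (\<Sum>i=1..m. min (hits m (E N) U i) (hits m (E N) V i + 1))"
      if "U \<subseteq> {1..2 * m}" "V \<subseteq> {1..2 * m}" "card U \<le> k" "card V \<le> k" for U V k
    proof (rule expander_cut[OF C(1) assms(2,3) C(2,3) assms(8) C34 E _ _ that])
      show "expander (2 * m) \<alpha> (pw_linear C1 C2 C3 C4 C5 C6 \<alpha>) (E N)" if "\<alpha> \<in> {0..1}" for \<alpha>
        using assms(11)[OF that, of "2 * m"] unfolding N .
      show "pair_expander (2 * m) \<alpha> 1 (half_pairs (2 * m)) (E N)" if "\<alpha> \<in> {0..C3}" for \<alpha>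
        using assms(12)[OF _ that, of "2 * m"] unfolding N by simp
    qed
    show ?case
      using superconcentrator_step[OF E IH inj inter verts arcs cut] unfolding fim N[symmetric] by blast
  qed
  then show ?thesis by blast
qed

end
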